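(* Let (S) denote the Hamiltonian system in $(x,y,z,w)$ (with $\dot x=\partial_yH$, $\dot y=-\partial_xH$, $\dot z=\partial_wH$, $\dot w=-\partial_zH$) with Hamiltonian $$H=H_{VI}(x,y,t;\alpha_0,\alpha_1,\alpha_2,\alpha_3,\alpha_4)+H_{VI}(z,w,t;\beta_0,\beta_1,\beta_2,\beta_3,\beta_4)+\frac{2(x-t)yz\{(z-1)w+\beta_2\}}{t(t-1)}.$$ Make the change of parameters and variables $$\alpha_0=A_0,\quad \alpha_1=A_1,\quad \alpha_2=A_2,\quad \alpha_4-\beta_4=A_3,\quad \beta_2=A_4,\quad \beta_4=A_5,\quad \tfrac{\beta_3-\beta_4}{2}=A_6,$$ $$X=x,\quad Y=y,\quad Z=\frac1z,\quad W=-z(zw+\beta_2)$$ from $\alpha_0,\alpha_1,\alpha_2,\alpha_4,\beta_2,\beta_3,\beta_4,x,y,z,w$ to $A_0,\dots,A_6,X,Y,Z,W$. Then (S) can also be written in the new variables $X,Y,Z,W$ and parameters $A_0,\dots,A_6$ as a Hamiltonian system, and this new system is the Hamiltonian system in $(X,Y,Z,W)$ with Hamiltonian \begin{align*} &H_{VI}(X,Y,t;A_0,A_1,A_2,A_3+A_5+2A_6,A_3+2A_4+A_5)\\ &+\tilde H_{VI}(Z,W,t;A_0+A_3,A_1+2A_2+A_3,A_4,A_5+2A_6,A_5)+\frac{2(X-t)Y(Z-1)W}{t(t-1)}. \end{align*}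
   Context: For parameters with $\delta_0+\delta_1+2\delta_2+\delta_3+\delta_4=1$, $$H_{VI}(q,p,t;\delta_0,\dots,\delta_4)=\tfrac{1}{t(t-1)}\big[p^2(q-t)(q-1)q-\{(\delta_0-1)(q-1)q+\delta_3(q-t)q+\delta_4(q-t)(q-1)\}p+\delta_2(\delta_1+\delta_2)q\big],$$ $$\tilde H_{VI}(Q,P,t;\delta_0,\dots,\delta_4)=\tfrac{1}{t(t-1)}\big[P^2(tQ-1)(Q-1)Q-\{(\delta_0-1)t(Q-1)Q+\delta_1(Q-1)(tQ-1)+\delta_3Q(tQ-1)\}P+\delta_2(\delta_2+\delta_4)tQ\big].$$ The free parameters of (S) are complex numbers $\alpha_0,\alpha_1,\alpha_2,\alpha_4,\beta_2,\beta_3,\beta_4$ with $\alpha_0+\alpha_1+2\alpha_2+2(\alpha_4-\beta_4)+2\beta_2+\beta_3+\beta_4=1$ (equivalently $A_0+A_1+2A_2+2A_3+2A_4+2A_5+2A_6=1$); the other parameters are determined by $\alpha_3=\alpha_4-\beta_4+2\beta_2+\beta_3$, $\beta_0=\alpha_0+\alpha_4-\beta_4$, $\beta_1=\alpha_1+2\alpha_2+\alpha_4-\beta_4$. *)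

theory Defs
  imports "HOL-Analysis.Analysis"
begin

definition H_VI ::
  "complex \<Rightarrow> complex \<Rightarrow> complex \<Rightarrow> complex \<Rightarrow> complex \<Rightarrow> complex \<Rightarrow> complex \<Rightarrow> complex \<Rightarrow> complex"
where
  "H_VI q p t \<delta>\<^sub>0 \<delta>\<^sub>1 \<delta>\<^sub>2 \<delta>\<^sub>3 \<delta>\<^sub>4 =
     1 / (t * (t - 1)) *
       (p\<^sup>2 * (q - t) * (q - 1) * q
        - ((\<delta>\<^sub>0 - 1) * (q - 1) * q + \<delta>\<^sub>3 * (q - t) * q + \<delta>\<^sub>4 * (q - t) * (q - 1)) * p
        + \<delta>\<^sub>2 * (\<delta>\<^sub>1 + \<delta>\<^sub>2) * q)"

definition H_VI_tilde ::
  "complex \<Rightarrow> complex \<Rightarrow> complex \<Rightarrow> complex \<Rightarrow> complex \<Rightarrow> complex \<Rightarrow> complex \<Rightarrow> complex \<Rightarrow> complex"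
where
  "H_VI_tilde Q P t \<delta>\<^sub>0 \<delta>\<^sub>1 \<delta>\<^sub>2 \<delta>\<^sub>3 \<delta>\<^sub>4 =
     1 / (t * (t - 1)) *
       (P\<^sup>2 * (t * Q - 1) * (Q - 1) * Q
        - ((\<delta>\<^sub>0 - 1) * t * (Q - 1) * Q + \<delta>\<^sub>1 * (Q - 1) * (t * Q - 1) + \<delta>\<^sub>3 * Q * (t * Q - 1)) * P
        + \<delta>\<^sub>2 * (\<delta>\<^sub>2 + \<delta>\<^sub>4) * t * Q)"

text \<open>The constraint under which the two Hamiltonians above are considered.\<close>

definition VI_params :: "complex \<Rightarrow> complex \<Rightarrow> complex \<Rightarrow> complex \<Rightarrow> complex \<Rightarrow> bool" where
  "VI_params \<delta>\<^sub>0 \<delta>\<^sub>1 \<delta>\<^sub>2 \<delta>\<^sub>3 \<delta>\<^sub>4 \<longleftrightarrow> \<delta>\<^sub>0 + \<delta>\<^sub>1 + 2 * \<delta>\<^sub>2 + \<delta>\<^sub>3 + \<delta>\<^sub>4 = 1"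

text \<open>
  A Hamiltonian takes its arguments in the order x, y, z, w, t, where (x, y) and (z, w) are
  the canonically conjugate pairs and t is the independent variable.
  The functions x, y, z, w solve the Hamiltonian system on U if at every point of U they
  are complex differentiable with the derivatives prescribed by the partial derivatives of H.
  The operator deriv is total; the Hamiltonians used below are polynomial in x, y, z, w, so
  it does denote their partial derivatives.
\<close>

definition hamiltonian_solution ::
  "(complex \<Rightarrow> complex \<Rightarrow> complex \<Rightarrow> complex \<Rightarrow> complex \<Rightarrow> complex) \<Rightarrow> complex set \<Rightarrow>
   (complex \<Rightarrow> complex) \<Rightarrow> (complex \<Rightarrow> complex) \<Rightarrow> (complex \<Rightarrow> complex) \<Rightarrow> (complex \<Rightarrow> complex) \<Rightarrow> bool"
where
  "hamiltonian_solution H U x y z w \<longleftrightarrow>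
     (\<forall>t\<in>U.
        (x has_field_derivative deriv (\<lambda>\<eta>. H (x t) \<eta> (z t) (w t) t) (y t)) (at t) \<and>
        (y has_field_derivative - deriv (\<lambda>\<xi>. H \<xi> (y t) (z t) (w t) t) (x t)) (at t) \<and>
        (z has_field_derivative deriv (\<lambda>\<omega>. H (x t) (y t) (z t) \<omega> t) (w t)) (at t) \<and>
        (w has_field_derivative - deriv (\<lambda>\<zeta>. H (x t) (y t) \<zeta> (w t) t) (z t)) (at t))"

definition S_params :: "(complex \<times> complex \<times> complex \<times> complex \<times> complex \<times> complex \<times> complex) set" where
  "S_params = {(\<alpha>\<^sub>0, \<alpha>\<^sub>1, \<alpha>\<^sub>2, \<alpha>\<^sub>4, \<beta>\<^sub>2, \<beta>\<^sub>3, \<beta>\<^sub>4).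
     \<alpha>\<^sub>0 + \<alpha>\<^sub>1 + 2 * \<alpha>\<^sub>2 + 2 * (\<alpha>\<^sub>4 - \<beta>\<^sub>4) + 2 * \<beta>\<^sub>2 + \<beta>\<^sub>3 + \<beta>\<^sub>4 = 1}"

definition A_params :: "(complex \<times> complex \<times> complex \<times> complex \<times> complex \<times> complex \<times> complex) set" where
  "A_params = {(A\<^sub>0, A\<^sub>1, A\<^sub>2, A\<^sub>3, A\<^sub>4, A\<^sub>5, A\<^sub>6).
     A\<^sub>0 + A\<^sub>1 + 2 * A\<^sub>2 + 2 * A\<^sub>3 + 2 * A\<^sub>4 + 2 * A\<^sub>5 + 2 * A\<^sub>6 = 1}"

definition H_S ::
  "complex \<Rightarrow> complex \<Rightarrow> complex \<Rightarrow> complex \<Rightarrow> complex \<Rightarrow> complex \<Rightarrow> complex \<Rightarrow>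
   complex \<Rightarrow> complex \<Rightarrow> complex \<Rightarrow> complex \<Rightarrow> complex \<Rightarrow> complex"
where
  "H_S \<alpha>\<^sub>0 \<alpha>\<^sub>1 \<alpha>\<^sub>2 \<alpha>\<^sub>4 \<beta>\<^sub>2 \<beta>\<^sub>3 \<beta>\<^sub>4 x y z w t =
     (let \<alpha>\<^sub>3 = \<alpha>\<^sub>4 - \<beta>\<^sub>4 + 2 * \<beta>\<^sub>2 + \<beta>\<^sub>3;
          \<beta>\<^sub>0 = \<alpha>\<^sub>0 + \<alpha>\<^sub>4 - \<beta>\<^sub>4;
          \<beta>\<^sub>1 = \<alpha>\<^sub>1 + 2 * \<alpha>\<^sub>2 + \<alpha>\<^sub>4 - \<beta>\<^sub>4
      in H_VI x y t \<alpha>\<^sub>0 \<alpha>\<^sub>1 \<alpha>\<^sub>2 \<alpha>\<^sub>3 \<alpha>\<^sub>4 + H_VI z w t \<beta>\<^sub>0 \<beta>\<^sub>1 \<beta>\<^sub>2 \<beta>\<^sub>3 \<beta>\<^sub>4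
         + 2 * (x - t) * y * z * ((z - 1) * w + \<beta>\<^sub>2) / (t * (t - 1)))"

definition H_A ::
  "complex \<Rightarrow> complex \<Rightarrow> complex \<Rightarrow> complex \<Rightarrow> complex \<Rightarrow> complex \<Rightarrow> complex \<Rightarrow>
   complex \<Rightarrow> complex \<Rightarrow> complex \<Rightarrow> complex \<Rightarrow> complex \<Rightarrow> complex"
where
  "H_A A\<^sub>0 A\<^sub>1 A\<^sub>2 A\<^sub>3 A\<^sub>4 A\<^sub>5 A\<^sub>6 X Y Z W t =
     H_VI X Y t A\<^sub>0 A\<^sub>1 A\<^sub>2 (A\<^sub>3 + A\<^sub>5 + 2 * A\<^sub>6) (A\<^sub>3 + 2 * A\<^sub>4 + A\<^sub>5)
     + H_VI_tilde Z W t (A\<^sub>0 + A\<^sub>3) (A\<^sub>1 + 2 * A\<^sub>2 + A\<^sub>3) A\<^sub>4 (A\<^sub>5 + 2 * A\<^sub>6) A\<^sub>5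
     + 2 * (X - t) * Y * (Z - 1) * W / (t * (t - 1))"

text \<open>
  The parameter constraints guarantee that every instance of the two basic Hamiltonians
  occurring above satisfies its own constraint.
\<close>

lemma S_params_VI_params:
  assumes "(\<alpha>\<^sub>0, \<alpha>\<^sub>1, \<alpha>\<^sub>2, \<alpha>\<^sub>4, \<beta>\<^sub>2, \<beta>\<^sub>3, \<beta>\<^sub>4) \<in> S_params"
  shows "VI_params \<alpha>\<^sub>0 \<alpha>\<^sub>1 \<alpha>\<^sub>2 (\<alpha>\<^sub>4 - \<beta>\<^sub>4 + 2 * \<beta>\<^sub>2 + \<beta>\<^sub>3) \<alpha>\<^sub>4"
    and "VI_params (\<alpha>\<^sub>0 + \<alpha>\<^sub>4 - \<beta>\<^sub>4) (\<alpha>\<^sub>1 + 2 * \<alpha>\<^sub>2 + \<alpha>\<^sub>4 - \<beta>\<^sub>4) \<beta>\<^sub>2 \<beta>\<^sub>3 \<beta>\<^sub>4"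
  using assms by (simp_all add: S_params_def VI_params_def algebra_simps)

lemma A_params_VI_params:
  assumes "(A\<^sub>0, A\<^sub>1, A\<^sub>2, A\<^sub>3, A\<^sub>4, A\<^sub>5, A\<^sub>6) \<in> A_params"
  shows "VI_params A\<^sub>0 A\<^sub>1 A\<^sub>2 (A\<^sub>3 + A\<^sub>5 + 2 * A\<^sub>6) (A\<^sub>3 + 2 * A\<^sub>4 + A\<^sub>5)"
    and "VI_params (A\<^sub>0 + A\<^sub>3) (A\<^sub>1 + 2 * A\<^sub>2 + A\<^sub>3) A\<^sub>4 (A\<^sub>5 + 2 * A\<^sub>6) A\<^sub>5"
  using assms by (simp_all add: A_params_def VI_params_def algebra_simps)

definition param_change ::
  "complex \<times> complex \<times> complex \<times> complex \<times> complex \<times> complex \<times> complex \<Rightarrow>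
   complex \<times> complex \<times> complex \<times> complex \<times> complex \<times> complex \<times> complex"
where
  "param_change = (\<lambda>(\<alpha>\<^sub>0, \<alpha>\<^sub>1, \<alpha>\<^sub>2, \<alpha>\<^sub>4, \<beta>\<^sub>2, \<beta>\<^sub>3, \<beta>\<^sub>4).
     (\<alpha>\<^sub>0, \<alpha>\<^sub>1, \<alpha>\<^sub>2, \<alpha>\<^sub>4 - \<beta>\<^sub>4, \<beta>\<^sub>2, \<beta>\<^sub>4, (\<beta>\<^sub>3 - \<beta>\<^sub>4) / 2))"

text \<open>The change of variables is meaningful only for nonzero z (HOL sets 1 / 0 = 0).\<close>

definition var_change ::
  "complex \<Rightarrow> complex \<times> complex \<times> complex \<times> complex \<Rightarrow> complex \<times> complex \<times> complex \<times> complex"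
where
  "var_change \<beta>\<^sub>2 = (\<lambda>(x, y, z, w). (x, y, 1 / z, - z * (z * w + \<beta>\<^sub>2)))"

end

theory Submission
  imports Defs
begin

text \<open>
  The map \<open>(z, w) \<mapsto> (1 / z, - z (z w + \<beta>\<^sub>2))\<close> is an involution on \<open>z \<noteq> 0\<close> with Jacobian
  determinant 1, it does not depend on \<open>t\<close>, and it carries one Hamiltonian to the other up to a
  term depending on \<open>t\<close> only. Canonical transformations preserve Hamiltonian systems, and by the
  involution property one implication of the equivalence gives both.
\<close>

section \<open>Complex partial derivatives and the chain rule in two variables\<close>

text \<open>No differentiability of \<open>f\<close> is assumed: both functions have exactly the
  same derivatives \<open>D\<close>, so the choice behind \<open>deriv\<close> agrees even where
  there is none. This covers the \<open>x\<close> and \<open>y\<close> directions, for which no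
  differentiability of the Hamiltonian is recorded.\<close>

lemma deriv_add_const: "deriv (\<lambda>x. f x + c) a = deriv f a"
  for f :: "complex \<Rightarrow> complex"
proof -
  have "((\<lambda>x. f x + c) has_field_derivative D) (at a) \<longleftrightarrow> (f has_field_derivative D) (at a)" for D
    using DERIV_add[of "\<lambda>x. f x + c" D a UNIV "\<lambda>_. - c" 0] DERIV_add[of f D a UNIV "\<lambda>_. c" 0]
    by auto
  then show ?thesis
    by (simp add: deriv_def)
qed

text \<open>
  The predicate \<open>differentiable\<close> only provides a real-linear derivative on \<open>complex \<times> complex\<close>;
  complex differentiability of the partial functions makes it complex-linear.
\<close>

lemma has_derivative_partials:
  fixes F :: "complex \<times> complex \<Rightarrow> complex"
  assumes "F differentiable at (z, w)"
    and 1: "(\<lambda>\<zeta>. F (\<zeta>, w)) field_differentiable at z"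
    and 2: "(\<lambda>\<omega>. F (z, \<omega>)) field_differentiable at w"
  shows "(F has_derivative (\<lambda>(a, b). deriv (\<lambda>\<zeta>. F (\<zeta>, w)) z * a + deriv (\<lambda>\<omega>. F (z, \<omega>)) w * b))
    (at (z, w))"
proof -
  obtain F' where F': "(F has_derivative F') (at (z, w))"
    using assms(1) by (auto simp: differentiable_def)
  have "((\<lambda>\<zeta>. F (\<zeta>, w)) has_derivative (\<lambda>a. F' (a, 0))) (at z)"
    by (rule has_derivative_compose[OF has_derivative_Pair[OF has_derivative_ident has_derivative_const] F'])
  moreover have "((\<lambda>\<zeta>. F (\<zeta>, w)) has_derivative (*) (deriv (\<lambda>\<zeta>. F (\<zeta>, w)) z)) (at z)"
    using field_differentiable_derivI[OF 1] unfolding has_field_derivative_def .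
  ultimately have Fz: "(\<lambda>a. F' (a, 0)) = (*) (deriv (\<lambda>\<zeta>. F (\<zeta>, w)) z)"
    by (rule has_derivative_unique)
  have "((\<lambda>\<omega>. F (z, \<omega>)) has_derivative (\<lambda>b. F' (0, b))) (at w)"
    by (rule has_derivative_compose[OF has_derivative_Pair[OF has_derivative_const has_derivative_ident] F'])
  moreover have "((\<lambda>\<omega>. F (z, \<omega>)) has_derivative (*) (deriv (\<lambda>\<omega>. F (z, \<omega>)) w)) (at w)"
    using field_differentiable_derivI[OF 2] unfolding has_field_derivative_def .
  ultimately have Fw: "(\<lambda>b. F' (0, b)) = (*) (deriv (\<lambda>\<omega>. F (z, \<omega>)) w)"
    by (rule has_derivative_unique)
  have "F' (a, b) = deriv (\<lambda>\<zeta>. F (\<zeta>, w)) z * a + deriv (\<lambda>\<omega>. F (z, \<omega>)) w * b" for a b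
    using linear_add[OF has_derivative_linear[OF F'], of "(a, 0)" "(0, b)"]
      fun_cong[OF Fz, of a] fun_cong[OF Fw, of b] by simp
  then have "F' = (\<lambda>(a, b). deriv (\<lambda>\<zeta>. F (\<zeta>, w)) z * a + deriv (\<lambda>\<omega>. F (z, \<omega>)) w * b)"
    by (simp add: fun_eq_iff)
  with F' show ?thesis by simp
qed

lemma has_field_derivative_compose_pair:
  fixes F :: "complex \<times> complex \<Rightarrow> complex"
  assumes F: "(F has_derivative (\<lambda>(a, b). p * a + q * b)) (at (f s, g s))"
    and f: "(f has_field_derivative f') (at s)" and g: "(g has_field_derivative g') (at s)"
  shows "((\<lambda>s. F (f s, g s)) has_field_derivative p * f' + q * g') (at s)"
proof -
  have "((\<lambda>s. (f s, g s)) has_derivative (\<lambda>h. (f' * h, g' * h))) (at s)"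
    using f g by (intro has_derivative_Pair) (auto simp: has_field_derivative_def)
  from has_derivative_compose[OF this F] have "((\<lambda>s. F (f s, g s)) has_derivative (\<lambda>h. (p * f' + q * g') * h)) (at s)"
    by (simp add: algebra_simps)
  then show ?thesis
    by (simp add: has_field_derivative_def)
qed

section \<open>Transport of solutions along the change of variables\<close>

text \<open>Only the pair \<open>(z, w)\<close> is mixed by the change of variables, so the chain
  rule is applied in these two variables alone. The three conjuncts are the hypotheses of
  \<open>has_derivative_partials\<close>.\<close>

definition differentiable_in_zw ::
  "(complex \<Rightarrow> complex \<Rightarrow> complex \<Rightarrow> complex \<Rightarrow> complex \<Rightarrow> complex) \<Rightarrow> bool"
where
  "differentiable_in_zw H \<longleftrightarrow> (\<forall>x y z w t.
     (\<lambda>(\<zeta>, \<omega>). H x y \<zeta> \<omega> t) differentiable at (z, w) \<and>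
     (\<lambda>\<zeta>. H x y \<zeta> w t) field_differentiable at z \<and>
     (\<lambda>\<omega>. H x y z \<omega> t) field_differentiable at w)"

text \<open>With \<open>Z = 1 / z\<close> and \<open>W = - z * (z * w + \<beta>)\<close> one has
  \<open>Z * W = - (z * w + \<beta>)\<close>, so \<open>Z * W + \<beta> = - z * w\<close> and
  \<open>- Z * (Z * W + \<beta>) = w\<close>.\<close>

lemma var_change_involution:
  assumes "z \<noteq> 0"
  shows "var_change \<beta> (var_change \<beta> (x, y, z, w)) = (x, y, z, w)"
  using assms by (simp add: var_change_def field_simps)

text \<open>Stated for arbitrary \<open>H\<close> and \<open>K\<close> so that it serves both
  directions of the equivalence. The equations for \<open>x\<close> and \<open>y\<close> carry over
  because the map fixes these variables; those for \<open>z\<close> and \<open>w\<close> follow by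
  the chain rule. The term \<open>c t\<close> disappears because partial derivatives of the
  Hamiltonian are taken at fixed \<open>t\<close>. Openness of \<open>U\<close> lets derivatives at
  \<open>t\<close> pass between functions that agree only on \<open>U\<close>.\<close>

lemma hamiltonian_solution_var_change:
  assumes "open U"
    and change: "\<And>t. t \<in> U \<Longrightarrow> z t \<noteq> 0 \<and> (X t, Y t, Z t, W t) = var_change \<beta> (x t, y t, z t, w t)"
    and diff: "differentiable_in_zw H"
    and HK: "\<And>x y z w t. z \<noteq> 0 \<Longrightarrow> K x y z w t = H x y (1 / z) (- z * (z * w + \<beta>)) t + c t"
    and sol: "hamiltonian_solution H U x y z w"
  shows "hamiltonian_solution K U X Y Z W"
  unfolding hamiltonian_solution_def
proof (intro ballI)
  fix t assume t: "t \<in> U"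
  have nz: "z t \<noteq> 0" and Znz: "Z t \<noteq> 0"
    and eqs: "X s = x s" "Y s = y s" "Z s = 1 / z s" "W s = - z s * (z s * w s + \<beta>)" if "s \<in> U" for s
    using change[OF t] change[OF that] by (auto simp: var_change_def)
  note [simp] = nz[OF t] Znz[OF t]
  have inv: "1 / Z t = z t" "- Z t * (Z t * W t + \<beta>) = w t"
    using var_change_involution[of "z t" \<beta> "x t" "y t" "w t"] eqs[OF t] by (simp_all add: var_change_def)
  \<comment> \<open>All \<open>Z\<close> and \<open>W\<close> partial derivatives of
    \<open>K\<close> and the velocities of \<open>Z\<close> and \<open>W\<close> are expressed
    through the gradient \<open>(p, q)\<close> of \<open>H\<close> at the old point, where
    \<open>z' = q\<close> and \<open>w' = - p\<close>.\<close>
  define p where "p = deriv (\<lambda>\<zeta>. H (x t) (y t) \<zeta> (w t) t) (z t)"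
  define q where "q = deriv (\<lambda>\<omega>. H (x t) (y t) (z t) \<omega> t) (w t)"
  define F where "F = (\<lambda>(\<zeta>, \<omega>). H (x t) (y t) \<zeta> \<omega> t)"
  have F: "(F has_derivative (\<lambda>(a, b). p * a + q * b)) (at (z t, w t))"
    using has_derivative_partials[of F "z t" "w t"] diff
    by (simp add: F_def p_def q_def differentiable_in_zw_def)
  have KF: "K (X t) (Y t) \<zeta> \<omega> t = F (1 / \<zeta>, - \<zeta> * (\<zeta> * \<omega> + \<beta>)) + c t" if "\<zeta> \<noteq> 0" for \<zeta> \<omega>
    using HK[OF that] eqs[OF t] by (simp add: F_def)
  from sol t have
    dx: "(x has_field_derivative deriv (\<lambda>\<eta>. H (x t) \<eta> (z t) (w t) t) (y t)) (at t)" and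
    dy: "(y has_field_derivative - deriv (\<lambda>\<xi>. H \<xi> (y t) (z t) (w t) t) (x t)) (at t)" and
    dz: "(z has_field_derivative q) (at t)" and
    dw: "(w has_field_derivative - p) (at t)"
    by (auto simp: hamiltonian_solution_def p_def q_def)
  \<comment> \<open>By \<open>inv\<close>, evaluating \<open>K\<close> at \<open>(Z t, W t)\<close>
    means evaluating \<open>H\<close> at \<open>(z t, w t)\<close>, whatever the first two arguments
    are.\<close>
  have "(\<lambda>\<eta>. K (X t) \<eta> (Z t) (W t) t) = (\<lambda>\<eta>. H (x t) \<eta> (z t) (w t) t + c t)"
    using HK[OF Znz[OF t]] inv eqs(1)[OF t] by simp
  then have "deriv (\<lambda>\<eta>. K (X t) \<eta> (Z t) (W t) t) (Y t) = deriv (\<lambda>\<eta>. H (x t) \<eta> (z t) (w t) t) (y t)"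
    by (simp add: deriv_add_const eqs[OF t])
  with dx have dX: "(X has_field_derivative deriv (\<lambda>\<eta>. K (X t) \<eta> (Z t) (W t) t) (Y t)) (at t)"
    using has_field_derivative_transform_within_open[OF _ \<open>open U\<close> t] eqs(1) by metis
  have "(\<lambda>\<xi>. K \<xi> (Y t) (Z t) (W t) t) = (\<lambda>\<xi>. H \<xi> (y t) (z t) (w t) t + c t)"
    using HK[OF Znz[OF t]] inv eqs(2)[OF t] by simp
  then have "deriv (\<lambda>\<xi>. K \<xi> (Y t) (Z t) (W t) t) (X t) = deriv (\<lambda>\<xi>. H \<xi> (y t) (z t) (w t) t) (x t)"
    by (simp add: deriv_add_const eqs[OF t])
  with dy have dY: "(Y has_field_derivative - deriv (\<lambda>\<xi>. K \<xi> (Y t) (Z t) (W t) t) (X t)) (at t)"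
    using has_field_derivative_transform_within_open[OF _ \<open>open U\<close> t] eqs(2) by metis
  have F': "(F has_derivative (\<lambda>(a, b). p * a + q * b)) (at (1 / Z t, - Z t * (Z t * W t + \<beta>)))"
    using F unfolding inv .
  have "((\<lambda>\<omega>. F (1 / Z t, - Z t * (Z t * \<omega> + \<beta>))) has_field_derivative p * 0 + q * (- (Z t)\<^sup>2)) (at (W t))"
    by (rule has_field_derivative_compose_pair[where f = "\<lambda>_. 1 / Z t"
        and g = "\<lambda>\<omega>. - Z t * (Z t * \<omega> + \<beta>)" and s = "W t", OF F'])
      (auto intro!: derivative_eq_intros simp: power2_eq_square)
  then have KW: "deriv (\<lambda>\<omega>. K (X t) (Y t) (Z t) \<omega> t) (W t) = - q * (Z t)\<^sup>2"
    by (simp add: KF deriv_add_const DERIV_imp_deriv)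
  have "((\<lambda>\<zeta>. F (1 / \<zeta>, - \<zeta> * (\<zeta> * W t + \<beta>))) has_field_derivative
      p * (- 1 / (Z t)\<^sup>2) + q * (- 2 * Z t * W t - \<beta>)) (at (Z t))"
    by (rule has_field_derivative_compose_pair[where f = "\<lambda>\<zeta>. 1 / \<zeta>" and s = "Z t"
        and g = "\<lambda>\<zeta>. - \<zeta> * (\<zeta> * W t + \<beta>)", OF F'])
      (auto intro!: derivative_eq_intros simp: power2_eq_square)
  then have "((\<lambda>\<zeta>. F (1 / \<zeta>, - \<zeta> * (\<zeta> * W t + \<beta>)) + c t) has_field_derivative
      p * (- 1 / (Z t)\<^sup>2) + q * (- 2 * Z t * W t - \<beta>)) (at (Z t))"
    by (auto intro!: derivative_eq_intros)
  \<comment> \<open>\<open>KF\<close> holds only for \<open>\<zeta> \<noteq> 0\<close>, so the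
    derivative is transferred on the open set \<open>- {0}\<close>, which contains
    \<open>Z t\<close>.\<close>
  then have "((\<lambda>\<zeta>. K (X t) (Y t) \<zeta> (W t) t) has_field_derivative
      p * (- 1 / (Z t)\<^sup>2) + q * (- 2 * Z t * W t - \<beta>)) (at (Z t))"
    by (rule has_field_derivative_transform_within_open[where S = "- {0}"]) (auto simp: KF)
  then have KZ: "deriv (\<lambda>\<zeta>. K (X t) (Y t) \<zeta> (W t) t) (Z t) =
      p * (- 1 / (Z t)\<^sup>2) + q * (- 2 * Z t * W t - \<beta>)"
    by (rule DERIV_imp_deriv)
  have "((\<lambda>s. 1 / z s) has_field_derivative - q * (Z t)\<^sup>2) (at t)"
    using eqs[OF t] by (auto intro!: derivative_eq_intros dz simp: field_simps power2_eq_square)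
  then have dZ: "(Z has_field_derivative deriv (\<lambda>\<omega>. K (X t) (Y t) (Z t) \<omega> t) (W t)) (at t)"
    unfolding KW by (rule has_field_derivative_transform_within_open[OF _ \<open>open U\<close> t]) (simp add: eqs)
  have "((\<lambda>s. - z s * (z s * w s + \<beta>)) has_field_derivative
      p * (z t)\<^sup>2 - q * (2 * (z t * w t) + \<beta>)) (at t)"
    by (auto intro!: derivative_eq_intros dz dw simp: algebra_simps power2_eq_square)
  \<comment> \<open>Both follow from \<open>Z * W = - (z * w + \<beta>)\<close> and
    \<open>Z = 1 / z\<close>; they turn the velocity of \<open>W\<close>, computed in old variables,
    into minus the \<open>Z\<close>-derivative of \<open>K\<close>.\<close>
  moreover have "- 2 * Z t * W t = 2 * (z t * w t + \<beta>)" "- 1 / (Z t)\<^sup>2 = - (z t)\<^sup>2"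
    using eqs[OF t] by (simp_all add: power_one_over)
  then have "p * (z t)\<^sup>2 - q * (2 * (z t * w t) + \<beta>) =
      - (p * (- 1 / (Z t)\<^sup>2) + q * (- 2 * Z t * W t - \<beta>))"
    by (simp add: algebra_simps)
  ultimately have "((\<lambda>s. - z s * (z s * w s + \<beta>)) has_field_derivative
      - (p * (- 1 / (Z t)\<^sup>2) + q * (- 2 * Z t * W t - \<beta>))) (at t)"
    by simp
  then have dW: "(W has_field_derivative - deriv (\<lambda>\<zeta>. K (X t) (Y t) \<zeta> (W t) t) (Z t)) (at t)"
    unfolding KZ by (rule has_field_derivative_transform_within_open[OF _ \<open>open U\<close> t]) (simp add: eqs)
  from dX dY dZ dW show "(X has_field_derivative deriv (\<lambda>\<eta>. K (X t) \<eta> (Z t) (W t) t) (Y t)) (at t) \<and>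
      (Y has_field_derivative - deriv (\<lambda>\<xi>. K \<xi> (Y t) (Z t) (W t) t) (X t)) (at t) \<and>
      (Z has_field_derivative deriv (\<lambda>\<omega>. K (X t) (Y t) (Z t) \<omega> t) (W t)) (at t) \<and>
      (W has_field_derivative - deriv (\<lambda>\<zeta>. K (X t) (Y t) \<zeta> (W t) t) (Z t)) (at t)"
    by blast
qed

lemma differentiable_H_S: "differentiable_in_zw (H_S \<alpha>\<^sub>0 \<alpha>\<^sub>1 \<alpha>\<^sub>2 \<alpha>\<^sub>4 \<beta>\<^sub>2 \<beta>\<^sub>3 \<beta>\<^sub>4)"
  \<comment> \<open>With division written as multiplication by \<open>inverse (t * (t - 1))\<close>,
    a constant in \<open>z\<close> and \<open>w\<close>, the Hamiltonian is a polynomial in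
    \<open>z\<close> and \<open>w\<close> for every \<open>t\<close>, including 0 and 1.\<close>
  unfolding differentiable_in_zw_def H_S_def H_VI_def Let_def case_prod_unfold divide_inverse
    power2_eq_square
  by (intro allI conjI derivative_intros
    bounded_linear_fst[THEN bounded_linear_imp_differentiable]
    bounded_linear_snd[THEN bounded_linear_imp_differentiable])

lemma differentiable_H_A: "differentiable_in_zw (H_A A\<^sub>0 A\<^sub>1 A\<^sub>2 A\<^sub>3 A\<^sub>4 A\<^sub>5 A\<^sub>6)"
  unfolding differentiable_in_zw_def H_A_def H_VI_def H_VI_tilde_def case_prod_unfold divide_inverse
    power2_eq_square
  by (intro allI conjI derivative_intros
    bounded_linear_fst[THEN bounded_linear_imp_differentiable]
    bounded_linear_snd[THEN bounded_linear_imp_differentiable])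

section \<open>Comparison of the two Hamiltonians\<close>

text \<open>Put \<open>v = z * w + \<delta>\<^sub>2\<close>, so \<open>W = - z * v\<close>.
  Multiplied by \<open>z\<close>, both brackets become quadratic polynomials in \<open>v\<close>.
  The parameter constraint makes their coefficients of \<open>v\<close> agree, and in the difference
  of the \<open>v\<close>-free parts it leaves only a multiple of \<open>z\<close>, which yields the
  term depending on \<open>t\<close> alone.\<close>

lemma H_VI_eq_H_VI_tilde:
  assumes "VI_params \<delta>\<^sub>0 \<delta>\<^sub>1 \<delta>\<^sub>2 \<delta>\<^sub>3 \<delta>\<^sub>4" and "z \<noteq> 0"
  shows "H_VI z w t \<delta>\<^sub>0 \<delta>\<^sub>1 \<delta>\<^sub>2 \<delta>\<^sub>3 \<delta>\<^sub>4 = H_VI_tilde (1 / z) (- z * (z * w + \<delta>\<^sub>2)) t \<delta>\<^sub>0 \<delta>\<^sub>1 \<delta>\<^sub>2 \<delta>\<^sub>3 \<delta>\<^sub>4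
    + 1 / (t * (t - 1)) * (\<delta>\<^sub>2 * (\<delta>\<^sub>2 * (1 + t) + (\<delta>\<^sub>0 - 1) * t + \<delta>\<^sub>1 * (1 + t) + \<delta>\<^sub>3))"
proof -
  have \<delta>\<^sub>4: "\<delta>\<^sub>4 = 1 - \<delta>\<^sub>0 - \<delta>\<^sub>1 - 2 * \<delta>\<^sub>2 - \<delta>\<^sub>3"
    using assms(1) by (simp add: VI_params_def algebra_simps)
  \<comment> \<open>Keeping \<open>Z\<close> opaque with the single relation
    \<open>z * Z = 1\<close> leaves only polynomial identities, within reach of
    \<open>algebra\<close>.\<close>
  define Z W v where "Z = 1 / z" and "W = - z * (z * w + \<delta>\<^sub>2)" and "v = z * w + \<delta>\<^sub>2"
  have zZ: "z * Z = 1" and W: "W = - z * v"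
    using assms(2) by (simp_all add: Z_def W_def v_def)
  \<comment> \<open>\<open>P\<close> and \<open>Q\<close> are the two brackets without the factor
    \<open>1 / (t * (t - 1))\<close>, \<open>R\<close> is \<open>z * Q\<close> as a polynomial in
    \<open>z\<close> and \<open>v\<close>, and \<open>C\<close> is the remainder.\<close>
  define P where "P = w\<^sup>2 * (z - t) * (z - 1) * z
    - ((\<delta>\<^sub>0 - 1) * (z - 1) * z + \<delta>\<^sub>3 * (z - t) * z + \<delta>\<^sub>4 * (z - t) * (z - 1)) * w
    + \<delta>\<^sub>2 * (\<delta>\<^sub>1 + \<delta>\<^sub>2) * z"
  define Q where "Q = W\<^sup>2 * (t * Z - 1) * (Z - 1) * Z
    - ((\<delta>\<^sub>0 - 1) * t * (Z - 1) * Z + \<delta>\<^sub>1 * (Z - 1) * (t * Z - 1) + \<delta>\<^sub>3 * Z * (t * Z - 1)) * W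
    + \<delta>\<^sub>2 * (\<delta>\<^sub>2 + \<delta>\<^sub>4) * t * Z"
  define R where "R = v\<^sup>2 * (t - z) * (1 - z)
    + ((\<delta>\<^sub>0 - 1) * t * (1 - z) + \<delta>\<^sub>1 * (1 - z) * (t - z) + \<delta>\<^sub>3 * (t - z)) * v + \<delta>\<^sub>2 * (\<delta>\<^sub>2 + \<delta>\<^sub>4) * t"
  define C where "C = \<delta>\<^sub>2 * (\<delta>\<^sub>2 * (1 + t) + (\<delta>\<^sub>0 - 1) * t + \<delta>\<^sub>1 * (1 + t) + \<delta>\<^sub>3)"
  have "W\<^sup>2 * (t * Z - 1) * (Z - 1) * Z = Z * (v\<^sup>2 * (t - z) * (1 - z))"
    "(Z - 1) * Z * W = - (Z * ((1 - z) * v))"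
    "(Z - 1) * (t * Z - 1) * W = - (Z * ((1 - z) * (t - z) * v))"
    "Z * (t * Z - 1) * W = - (Z * ((t - z) * v))"
    using zZ unfolding W by algebra+
  then have "Q = Z * R"
    unfolding Q_def R_def by algebra
  moreover have "z * P = R + z * C"
    unfolding P_def R_def C_def v_def \<delta>\<^sub>4 by algebra
  \<comment> \<open>Multiply \<open>z * P = R + z * C\<close> by \<open>Z\<close>.\<close>
  ultimately have "P = Q + C"
    using zZ by algebra
  then show ?thesis
    unfolding H_VI_def H_VI_tilde_def P_def Q_def C_def W_def Z_def by (simp only: distrib_left)
qed

text \<open>The \<open>(z, w)\<close> parts differ by a term in \<open>t\<close> alone, and the
  change in the coupling term is absorbed by the shifted parameters of the \<open>(x, y)\<close>
  part.\<close>

lemma H_S_eq_H_A: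
  assumes "(\<alpha>\<^sub>0, \<alpha>\<^sub>1, \<alpha>\<^sub>2, \<alpha>\<^sub>4, \<beta>\<^sub>2, \<beta>\<^sub>3, \<beta>\<^sub>4) \<in> S_params"
    and "(A\<^sub>0, A\<^sub>1, A\<^sub>2, A\<^sub>3, A\<^sub>4, A\<^sub>5, A\<^sub>6) = param_change (\<alpha>\<^sub>0, \<alpha>\<^sub>1, \<alpha>\<^sub>2, \<alpha>\<^sub>4, \<beta>\<^sub>2, \<beta>\<^sub>3, \<beta>\<^sub>4)"
  shows "\<exists>c. \<forall>x y z w. z \<noteq> 0 \<longrightarrow> H_S \<alpha>\<^sub>0 \<alpha>\<^sub>1 \<alpha>\<^sub>2 \<alpha>\<^sub>4 \<beta>\<^sub>2 \<beta>\<^sub>3 \<beta>\<^sub>4 x y z w t =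
    H_A A\<^sub>0 A\<^sub>1 A\<^sub>2 A\<^sub>3 A\<^sub>4 A\<^sub>5 A\<^sub>6 x y (1 / z) (- z * (z * w + \<beta>\<^sub>2)) t + c"
proof (intro exI allI impI)
  fix x y z w :: complex
  assume z: "z \<noteq> 0"
  have A: "A\<^sub>0 = \<alpha>\<^sub>0" "A\<^sub>1 = \<alpha>\<^sub>1" "A\<^sub>2 = \<alpha>\<^sub>2" "A\<^sub>3 = \<alpha>\<^sub>4 - \<beta>\<^sub>4" "A\<^sub>4 = \<beta>\<^sub>2" "A\<^sub>5 = \<beta>\<^sub>4" "A\<^sub>6 = (\<beta>\<^sub>3 - \<beta>\<^sub>4) / 2"
    using assms(2) unfolding param_change_def by simp_all
  \<comment> \<open>Up to the factor \<open>1 / (t * (t - 1))\<close>, the old coupling exceeds the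
    new one by \<open>2 * \<beta>\<^sub>2 * (x - t) * y\<close>. Moving
    \<open>2 * \<beta>\<^sub>2\<close> from the fourth to the fifth parameter of \<open>H_VI\<close>
    adds the same amount, since \<open>x - (x - 1) = 1\<close>.\<close>
  have coupling: "H_VI x y t \<alpha>\<^sub>0 \<alpha>\<^sub>1 \<alpha>\<^sub>2 (\<alpha>\<^sub>4 - \<beta>\<^sub>4 + 2 * \<beta>\<^sub>2 + \<beta>\<^sub>3) \<alpha>\<^sub>4
      + 2 * (x - t) * y * z * ((z - 1) * w + \<beta>\<^sub>2) / (t * (t - 1)) =
    H_VI x y t \<alpha>\<^sub>0 \<alpha>\<^sub>1 \<alpha>\<^sub>2 (\<alpha>\<^sub>4 - \<beta>\<^sub>4 + \<beta>\<^sub>3) (\<alpha>\<^sub>4 + 2 * \<beta>\<^sub>2)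
      + 2 * (x - t) * y * (1 / z - 1) * (- z * (z * w + \<beta>\<^sub>2)) / (t * (t - 1))"
  proof -
    have "2 * (x - t) * y * (1 / z - 1) * (- z * (z * w + \<beta>\<^sub>2)) = 2 * (x - t) * y * (z - 1) * (z * w + \<beta>\<^sub>2)"
      using z by (simp add: field_simps)
    then show ?thesis
      unfolding H_VI_def by (simp only:) (simp add: divide_inverse algebra_simps)
  qed
  have A': "A\<^sub>3 + A\<^sub>5 + 2 * A\<^sub>6 = \<alpha>\<^sub>4 - \<beta>\<^sub>4 + \<beta>\<^sub>3" "A\<^sub>3 + 2 * A\<^sub>4 + A\<^sub>5 = \<alpha>\<^sub>4 + 2 * \<beta>\<^sub>2"
    "A\<^sub>0 + A\<^sub>3 = \<alpha>\<^sub>0 + \<alpha>\<^sub>4 - \<beta>\<^sub>4" "A\<^sub>1 + 2 * A\<^sub>2 + A\<^sub>3 = \<alpha>\<^sub>1 + 2 * \<alpha>\<^sub>2 + \<alpha>\<^sub>4 - \<beta>\<^sub>4"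
    "A\<^sub>5 + 2 * A\<^sub>6 = \<beta>\<^sub>3"
    by (simp_all add: A field_simps)
  have HS: "H_S \<alpha>\<^sub>0 \<alpha>\<^sub>1 \<alpha>\<^sub>2 \<alpha>\<^sub>4 \<beta>\<^sub>2 \<beta>\<^sub>3 \<beta>\<^sub>4 x y z w t =
      H_VI x y t \<alpha>\<^sub>0 \<alpha>\<^sub>1 \<alpha>\<^sub>2 (\<alpha>\<^sub>4 - \<beta>\<^sub>4 + 2 * \<beta>\<^sub>2 + \<beta>\<^sub>3) \<alpha>\<^sub>4
      + 2 * (x - t) * y * z * ((z - 1) * w + \<beta>\<^sub>2) / (t * (t - 1))
      + H_VI z w t (\<alpha>\<^sub>0 + \<alpha>\<^sub>4 - \<beta>\<^sub>4) (\<alpha>\<^sub>1 + 2 * \<alpha>\<^sub>2 + \<alpha>\<^sub>4 - \<beta>\<^sub>4) \<beta>\<^sub>2 \<beta>\<^sub>3 \<beta>\<^sub>4"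
    by (simp only: H_S_def Let_def add_ac)
  have HA: "H_A A\<^sub>0 A\<^sub>1 A\<^sub>2 A\<^sub>3 A\<^sub>4 A\<^sub>5 A\<^sub>6 x y (1 / z) (- z * (z * w + \<beta>\<^sub>2)) t =
      H_VI x y t \<alpha>\<^sub>0 \<alpha>\<^sub>1 \<alpha>\<^sub>2 (\<alpha>\<^sub>4 - \<beta>\<^sub>4 + \<beta>\<^sub>3) (\<alpha>\<^sub>4 + 2 * \<beta>\<^sub>2)
      + 2 * (x - t) * y * (1 / z - 1) * (- z * (z * w + \<beta>\<^sub>2)) / (t * (t - 1))
      + H_VI_tilde (1 / z) (- z * (z * w + \<beta>\<^sub>2)) t
          (\<alpha>\<^sub>0 + \<alpha>\<^sub>4 - \<beta>\<^sub>4) (\<alpha>\<^sub>1 + 2 * \<alpha>\<^sub>2 + \<alpha>\<^sub>4 - \<beta>\<^sub>4) \<beta>\<^sub>2 \<beta>\<^sub>3 \<beta>\<^sub>4"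
    unfolding H_A_def A' unfolding A(1-3,5,6) by (simp only: add_ac)
  \<comment> \<open>The witness for \<open>c\<close> is the remainder from
    \<open>H_VI_eq_H_VI_tilde\<close> at the parameters of the \<open>(z, w)\<close> part.\<close>
  show "H_S \<alpha>\<^sub>0 \<alpha>\<^sub>1 \<alpha>\<^sub>2 \<alpha>\<^sub>4 \<beta>\<^sub>2 \<beta>\<^sub>3 \<beta>\<^sub>4 x y z w t =
    H_A A\<^sub>0 A\<^sub>1 A\<^sub>2 A\<^sub>3 A\<^sub>4 A\<^sub>5 A\<^sub>6 x y (1 / z) (- z * (z * w + \<beta>\<^sub>2)) t
    + 1 / (t * (t - 1)) * (\<beta>\<^sub>2 * (\<beta>\<^sub>2 * (1 + t) + (\<alpha>\<^sub>0 + \<alpha>\<^sub>4 - \<beta>\<^sub>4 - 1) * t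
      + (\<alpha>\<^sub>1 + 2 * \<alpha>\<^sub>2 + \<alpha>\<^sub>4 - \<beta>\<^sub>4) * (1 + t) + \<beta>\<^sub>3))"
    unfolding HS HA coupling H_VI_eq_H_VI_tilde[OF S_params_VI_params(2)[OF assms(1)] z]
    by (simp only: add.assoc)
qed

theorem theorem3p4:
  fixes \<alpha>\<^sub>0 \<alpha>\<^sub>1 \<alpha>\<^sub>2 \<alpha>\<^sub>4 \<beta>\<^sub>2 \<beta>\<^sub>3 \<beta>\<^sub>4 :: complex
    and A\<^sub>0 A\<^sub>1 A\<^sub>2 A\<^sub>3 A\<^sub>4 A\<^sub>5 A\<^sub>6 :: complex
  assumes "(\<alpha>\<^sub>0, \<alpha>\<^sub>1, \<alpha>\<^sub>2, \<alpha>\<^sub>4, \<beta>\<^sub>2, \<beta>\<^sub>3, \<beta>\<^sub>4) \<in> S_params"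
    and "(A\<^sub>0, A\<^sub>1, A\<^sub>2, A\<^sub>3, A\<^sub>4, A\<^sub>5, A\<^sub>6) = param_change (\<alpha>\<^sub>0, \<alpha>\<^sub>1, \<alpha>\<^sub>2, \<alpha>\<^sub>4, \<beta>\<^sub>2, \<beta>\<^sub>3, \<beta>\<^sub>4)"
  shows "bij_betw param_change S_params A_params \<and>
    bij_betw (var_change \<beta>\<^sub>2) {(x, y, z, w). z \<noteq> 0} {(X, Y, Z, W). Z \<noteq> 0} \<and>
    (\<forall>(U :: complex set) (x :: complex \<Rightarrow> complex) y z w X Y Z W.
       open U \<longrightarrow> 0 \<notin> U \<longrightarrow> 1 \<notin> U \<longrightarrow>
       (\<forall>t\<in>U. z t \<noteq> 0 \<and> (X t, Y t, Z t, W t) = var_change \<beta>\<^sub>2 (x t, y t, z t, w t)) \<longrightarrow>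
       (hamiltonian_solution (H_S \<alpha>\<^sub>0 \<alpha>\<^sub>1 \<alpha>\<^sub>2 \<alpha>\<^sub>4 \<beta>\<^sub>2 \<beta>\<^sub>3 \<beta>\<^sub>4) U x y z w \<longleftrightarrow>
        hamiltonian_solution (H_A A\<^sub>0 A\<^sub>1 A\<^sub>2 A\<^sub>3 A\<^sub>4 A\<^sub>5 A\<^sub>6) U X Y Z W))"
proof -
  have param: "bij_betw param_change S_params A_params"
    \<comment> \<open>The inverse solves the defining equations:
      \<open>\<beta>\<^sub>4 = A\<^sub>5\<close>,
      \<open>\<alpha>\<^sub>4 = A\<^sub>3 + A\<^sub>5\<close>,
      \<open>\<beta>\<^sub>3 = 2 * A\<^sub>6 + A\<^sub>5\<close>.\<close>
    by (rule bij_betw_byWitness[where f' = "\<lambda>(A\<^sub>0, A\<^sub>1, A\<^sub>2, A\<^sub>3, A\<^sub>4, A\<^sub>5, A\<^sub>6).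
      (A\<^sub>0, A\<^sub>1, A\<^sub>2, A\<^sub>3 + A\<^sub>5, A\<^sub>4, 2 * A\<^sub>6 + A\<^sub>5, A\<^sub>5)"])
      (auto simp: param_change_def S_params_def A_params_def add_divide_distrib diff_divide_distrib algebra_simps)
  have var: "bij_betw (var_change \<beta>\<^sub>2) {(x, y, z, w). z \<noteq> 0} {(X, Y, Z, W). Z \<noteq> 0}"
    by (rule bij_betw_byWitness[where f' = "var_change \<beta>\<^sub>2"])
      (auto simp: var_change_involution, auto simp: var_change_def)
  obtain c where SA: "H_S \<alpha>\<^sub>0 \<alpha>\<^sub>1 \<alpha>\<^sub>2 \<alpha>\<^sub>4 \<beta>\<^sub>2 \<beta>\<^sub>3 \<beta>\<^sub>4 x y z w t =
      H_A A\<^sub>0 A\<^sub>1 A\<^sub>2 A\<^sub>3 A\<^sub>4 A\<^sub>5 A\<^sub>6 x y (1 / z) (- z * (z * w + \<beta>\<^sub>2)) t + c t"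
    if "z \<noteq> 0" for x y z w t
    using H_S_eq_H_A[OF assms] by metis
  \<comment> \<open>This is \<open>SA\<close> at the image point, which the involution sends back to
    \<open>(z, w)\<close>.\<close>
  have AS: "H_A A\<^sub>0 A\<^sub>1 A\<^sub>2 A\<^sub>3 A\<^sub>4 A\<^sub>5 A\<^sub>6 x y z w t =
      H_S \<alpha>\<^sub>0 \<alpha>\<^sub>1 \<alpha>\<^sub>2 \<alpha>\<^sub>4 \<beta>\<^sub>2 \<beta>\<^sub>3 \<beta>\<^sub>4 x y (1 / z) (- z * (z * w + \<beta>\<^sub>2)) t + - c t"
    if "z \<noteq> 0" for x y z w t
    using SA[of "1 / z" x y "- z * (z * w + \<beta>\<^sub>2)" t] var_change_involution[OF that, of \<beta>\<^sub>2 x y w] that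
    by (simp add: var_change_def)
  have "hamiltonian_solution (H_S \<alpha>\<^sub>0 \<alpha>\<^sub>1 \<alpha>\<^sub>2 \<alpha>\<^sub>4 \<beta>\<^sub>2 \<beta>\<^sub>3 \<beta>\<^sub>4) U x y z w \<longleftrightarrow>
      hamiltonian_solution (H_A A\<^sub>0 A\<^sub>1 A\<^sub>2 A\<^sub>3 A\<^sub>4 A\<^sub>5 A\<^sub>6) U X Y Z W"
    if "open U"
      and change: "\<forall>t\<in>U. z t \<noteq> 0 \<and> (X t, Y t, Z t, W t) = var_change \<beta>\<^sub>2 (x t, y t, z t, w t)"
    for U and x y z w X Y Z W :: "complex \<Rightarrow> complex"
  proof
    assume sol: "hamiltonian_solution (H_S \<alpha>\<^sub>0 \<alpha>\<^sub>1 \<alpha>\<^sub>2 \<alpha>\<^sub>4 \<beta>\<^sub>2 \<beta>\<^sub>3 \<beta>\<^sub>4) U x y z w"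
    show "hamiltonian_solution (H_A A\<^sub>0 A\<^sub>1 A\<^sub>2 A\<^sub>3 A\<^sub>4 A\<^sub>5 A\<^sub>6) U X Y Z W"
      by (rule hamiltonian_solution_var_change[OF \<open>open U\<close> bspec[OF change] differentiable_H_S AS sol])
  next
    assume sol: "hamiltonian_solution (H_A A\<^sub>0 A\<^sub>1 A\<^sub>2 A\<^sub>3 A\<^sub>4 A\<^sub>5 A\<^sub>6) U X Y Z W"
    \<comment> \<open>The involution makes the relation between the two curves symmetric, so the
      transport lemma applies with the roles of the systems exchanged.\<close>
    have change': "Z t \<noteq> 0 \<and> (x t, y t, z t, w t) = var_change \<beta>\<^sub>2 (X t, Y t, Z t, W t)" if "t \<in> U" for t
    proof -
      have "z t \<noteq> 0" and eq: "(X t, Y t, Z t, W t) = var_change \<beta>\<^sub>2 (x t, y t, z t, w t)"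
        using change that by blast+
      then show ?thesis
        unfolding eq by (simp add: var_change_involution) (use eq in \<open>simp add: var_change_def\<close>)
    qed
    show "hamiltonian_solution (H_S \<alpha>\<^sub>0 \<alpha>\<^sub>1 \<alpha>\<^sub>2 \<alpha>\<^sub>4 \<beta>\<^sub>2 \<beta>\<^sub>3 \<beta>\<^sub>4) U x y z w"
      by (rule hamiltonian_solution_var_change[OF \<open>open U\<close> change' differentiable_H_A SA sol])
  qed
  with param var show ?thesis
    by blast
qed

end
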